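(* Let $f$ be a real-valued function that is smooth ($C^\infty$) in a neighbourhood of a point $x_i\in\mathbb{R}$, let $p>0$ be fixed, and for $\Delta x>0$ small put $f_{i+j}=f(x_i+j\Delta x)$, $j=-2,\dots,2$. Let $\omega^{\mathrm{ZR}}_k$, $k=0,1,2$, be the associated nonlinear weights with exponent $p$ and $\epsilon=0$. Then, as $\Delta x\to0^+$, for $k=0,1,2$: (1) if $f'(x_i)\neq0$, then $\omega^{\mathrm{ZR}}_k=d_k+O(\Delta x^{3p})$; in particular $\omega^{\mathrm{ZR}}_k-d_k=O(\Delta x^3)$ whenever $p\geq1$; (2) if $f'(x_i)=0$ and $f''(x_i)\neq0$, then $\omega^{\mathrm{ZR}}_k=d_k+O(\Delta x^{p})$; in particular $\omega^{\mathrm{ZR}}_k-d_k=O(\Delta x^3)$ whenever $p\geq3$.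
   Context: Linear weights: $d_0=\frac1{10}$, $d_1=\frac35$, $d_2=\frac3{10}$. Smoothness indicators of the five values $f_{i-2},\dots,f_{i+2}$: $$\beta_0=\tfrac{13}{12}(f_{i-2}-2f_{i-1}+f_i)^2+\tfrac14(f_{i-2}-4f_{i-1}+3f_i)^2,$$ $$\beta_1=\tfrac{13}{12}(f_{i-1}-2f_i+f_{i+1})^2+\tfrac14(f_{i-1}-f_{i+1})^2,$$ $$\beta_2=\tfrac{13}{12}(f_i-2f_{i+1}+f_{i+2})^2+\tfrac14(3f_i-4f_{i+1}+f_{i+2})^2.$$ For $p>0$ (and $\epsilon=0$), the global smoothness indicator is $\tau^{\mathrm{ZR}}_5=\left|\beta_0^{1/p}-\beta_2^{1/p}\right|$, and the nonlinear weights are $$\omega^{\mathrm{ZR}}_k=\frac{\alpha_k}{\sum_{s=0}^2\alpha_s},\qquad \alpha_k=d_k\left(1+\left(\frac{\tau^{\mathrm{ZR}}_5}{\beta_k^{1/p}}\right)^p\right),\qquad k=0,1,2.$$ Under either hypothesis (1) or (2), $\beta_0,\beta_1,\beta_2>0$ for all sufficiently small $\Delta x>0$, so the weights are well defined. The constants in the $O(\cdot)$ terms may depend on $f$, $x_i$ and $p$ but not on $\Delta x$. (Here $f$ denotes the flux $f(u(x))$ regarded as a function of $x$ at a fixed time.) *)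

theory Defs
  imports "HOL-Analysis.Analysis" "HOL-Library.Landau_Symbols"
begin

definition smooth_near :: "(real \<Rightarrow> real) \<Rightarrow> real \<Rightarrow> bool" where
  "smooth_near f x \<longleftrightarrow>
     (\<exists>U. open U \<and> x \<in> U \<and> (\<forall>n. (deriv ^^ n) f differentiable_on U))"

text \<open>
  Substencils are numbered by \<open>k = 0, 1, 2\<close>; quantities indexed by \<open>k\<close> are only meaningful
  in that range. A stencil is a function \<open>v\<close> with \<open>v j\<close> standing for $f_{i+j}$; only the
  values at \<open>j = -2, \<dots>, 2\<close> are used.
\<close>

definition linear_weight :: "nat \<Rightarrow> real" where
  "linear_weight k = [1/10, 3/5, 3/10] ! k"

definition stencil :: "(real \<Rightarrow> real) \<Rightarrow> real \<Rightarrow> real \<Rightarrow> int \<Rightarrow> real" where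
  "stencil f x h j = f (x + of_int j * h)"

definition smoothness_indicator :: "(int \<Rightarrow> real) \<Rightarrow> nat \<Rightarrow> real" where
  "smoothness_indicator v k =
     [13/12 * (v (-2) - 2 * v (-1) + v 0)^2 + 1/4 * (v (-2) - 4 * v (-1) + 3 * v 0)^2,
      13/12 * (v (-1) - 2 * v 0 + v 1)^2 + 1/4 * (v (-1) - v 1)^2,
      13/12 * (v 0 - 2 * v 1 + v 2)^2 + 1/4 * (3 * v 0 - 4 * v 1 + v 2)^2] ! k"

definition tau_ZR :: "real \<Rightarrow> (int \<Rightarrow> real) \<Rightarrow> real" where
  "tau_ZR p v =
     \<bar>smoothness_indicator v 0 powr (1/p) - smoothness_indicator v 2 powr (1/p)\<bar>"

text \<open>
  There is no regularisation in the denominators (\<open>\<epsilon> = 0\<close>), so the weights carry their intended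
  meaning only when all three smoothness indicators are positive.
\<close>

definition alpha_ZR :: "real \<Rightarrow> (int \<Rightarrow> real) \<Rightarrow> nat \<Rightarrow> real" where
  "alpha_ZR p v k =
     linear_weight k * (1 + (tau_ZR p v / smoothness_indicator v k powr (1/p)) powr p)"

definition omega_ZR :: "real \<Rightarrow> (int \<Rightarrow> real) \<Rightarrow> nat \<Rightarrow> real" where
  "omega_ZR p v k = alpha_ZR p v k / (\<Sum>s=0..2. alpha_ZR p v s)"

end

theory Submission
  imports Defs
begin

text \<open>
  Write $\beta_k = \frac{13}{12} P_k^2 + \frac14 Q_k^2$, where $P_k$ is a second and $Q_k$ a first
  undivided difference of the data. With $a = f'(x)$, $b = f''(x)$, Taylor's theorem gives
  $P_k = b h^2 + O(h^3)$ and $Q_k = \pm 2 a h + O(h^3)$. Two facts follow.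

  \<^item> All three $\beta_k$ have the same leading term $C h^m$ with $C > 0$: if $a \neq 0$, then
    $m = 2$ and $C = a^2$; if $a = 0 \neq b$, then $m = 4$ and $C = \frac{13}{12} b^2$
    (\<open>smoothness_indicator_leading_term\<close>).
  \<^item> Whatever $a$ and $b$ are, $\beta_0 - \beta_2 = O(h^5)$ (\<open>smoothness_indicator_diff\<close>). Indeed
    $\beta_0 - \beta_2 = \frac{13}{12} (P_0 - P_2)(P_0 + P_2) + \frac14 (Q_0 + Q_2)(Q_0 - Q_2)$,
    in which $P_0 - P_2 = O(h^3)$ because the leading terms cancel, $Q_0 + Q_2 = O(h^4)$ because it
    is the central fourth difference, and the other two factors are $O(h^2)$ and $O(h)$.

  After division by $h^m$ the indicators tend to $C > 0$, where $u \mapsto u^{1/p}$ is Lipschitz.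
  The quotients $\tau / \beta_k^{1/p}$ are unchanged by this scaling, so they are $O(h^{5 - m})$
  and their $p$-th powers are $O(h^{(5 - m) p})$. As the linear weights sum to 1, the nonlinear
  weights differ from them by no more than the sum of these $p$-th powers
  (\<open>omega_ZR_diff_le\<close>). The exponents are $3p$ for $m = 2$ and $p$ for $m = 4$.
\<close>

section \<open>Taylor expansion of the stencil values\<close>

text \<open>
  The Lagrange remainder is uniform in $h$ because the $n$-th derivative is continuous, hence
  bounded, on a compact interval around $x$.
\<close>

lemma smooth_near_taylor:
  fixes f :: "real \<Rightarrow> real"
  assumes "smooth_near f x"
  shows "(\<lambda>h. f (x + r * h) - (\<Sum>m<n. (deriv ^^ m) f x / fact m * (r * h) ^ m))
           \<in> O[at_right 0](\<lambda>h. h ^ n)"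
proof -
  obtain U where U: "open U" "x \<in> U" and diff: "\<And>m. (deriv ^^ m) f differentiable_on U"
    using assms unfolding smooth_near_def by blast
  have D: "((deriv ^^ m) f has_real_derivative (deriv ^^ Suc m) f t) (at t)" if "t \<in> U" for m t
    using diff[of m] U(1) that
    by (auto simp: differentiable_on_eq_differentiable_at DERIV_deriv_iff_real_differentiable)
  obtain e where e: "e > 0" "cball x e \<subseteq> U"
    using U open_contains_cball by blast
  have ball: "{x - e..x + e} \<subseteq> U"
    using e(2) by (simp add: cball_eq_atLeastAtMost)
  have "continuous_on {x - e..x + e} ((deriv ^^ n) f)"
    using differentiable_imp_continuous_on[OF diff] ball continuous_on_subset by blast
  then have "bounded ((deriv ^^ n) f ` {x - e..x + e})"
    by (intro compact_imp_bounded compact_continuous_image) auto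
  then obtain M where M: "\<And>t. t \<in> {x - e..x + e} \<Longrightarrow> \<bar>(deriv ^^ n) f t\<bar> \<le> M"
    unfolding bounded_iff by (metis imageI real_norm_def)
  have M0: "M \<ge> 0"
    using M[of x] e(1) by force
  have rem: "\<bar>f y - (\<Sum>m<n. (deriv ^^ m) f x / fact m * (y - x) ^ m)\<bar> \<le> M * \<bar>y - x\<bar> ^ n"
    if y: "y \<in> {x - e..x + e}" "y \<noteq> x" "n > 0" for y
  proof -
    obtain t where t: "if y < x then y < t \<and> t < x else x < t \<and> t < y"
      and eq: "f y = (\<Sum>m<n. (deriv ^^ m) f x / fact m * (y - x) ^ m)
                     + (deriv ^^ n) f t / fact n * (y - x) ^ n"
      using Taylor[of n "\<lambda>m. (deriv ^^ m) f" f "x - e" "x + e" x y] D ball y e(1)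
      by (fastforce simp del: funpow.simps(2))
    have "t \<in> {x - e..x + e}"
      using t y(1) e(1) by (auto split: if_splits)
    then have "\<bar>(deriv ^^ n) f t\<bar> / fact n \<le> M"
      using M[of t] fact_ge_1[of n, where 'a = real] M0
      by (smt (verit) divide_le_eq mult_left_le_one_le mult_le_cancel_left1 mult_nonneg_nonneg)
    then have "\<bar>(deriv ^^ n) f t / fact n * (y - x) ^ n\<bar> \<le> M * \<bar>y - x\<bar> ^ n"
      using mult_right_mono[of "\<bar>(deriv ^^ n) f t\<bar> / fact n" M "\<bar>y - x\<bar> ^ n"]
      by (simp add: abs_mult power_abs)
    then show ?thesis
      unfolding eq by simp
  qed
  have "((\<lambda>h. x + r * h) \<longlongrightarrow> x + r * 0) (at_right 0)"
    by (intro tendsto_intros)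
  then have "eventually (\<lambda>h. x + r * h \<in> {x - e<..<x + e}) (at_right 0)"
    using e(1) by (intro topological_tendstoD) auto
  then have "eventually (\<lambda>h. \<bar>f (x + r * h) - (\<Sum>m<n. (deriv ^^ m) f x / fact m * (r * h) ^ m)\<bar>
                            \<le> M * \<bar>r\<bar> ^ n * \<bar>h ^ n\<bar>) (at_right 0)"
  proof eventually_elim
    case (elim h)
    \<comment> \<open>The Lagrange form requires a positive order and a point other than the centre.\<close>
    consider "n = 0" | "n > 0" "r * h = 0" | "n > 0" "r * h \<noteq> 0" by blast
    then show ?case
    proof cases
      case 1
      then show ?thesis using elim M[of "x + r * h"] by simp
    next
      case 2
      then have eq: "(\<Sum>m<n. (deriv ^^ m) f x / fact m * (r * h) ^ m) = f x"
        by (subst sum.remove[of _ 0]) (auto simp: power_0_left)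
      show ?thesis unfolding eq using 2 M0 by auto
    next
      case 3
      then show ?thesis using rem[of "x + r * h"] elim
        by (auto simp: abs_mult power_mult_distrib power_abs mult.assoc)
    qed
  qed
  then show ?thesis
    by (intro bigoI[of _ "M * \<bar>r\<bar> ^ n"]) simp
qed

text \<open>
  With the remainders named, every difference formula below becomes a polynomial identity plus a
  fixed linear combination of the $R_j$.
\<close>

lemma stencil_taylor:
  assumes "smooth_near f x"
  obtains c R where
    "\<And>j h. stencil f x h j = f x + deriv f x * (of_int j * h) +
             deriv (deriv f) x / 2 * (of_int j * h) ^ 2 + c * (of_int j * h) ^ 3 + R j h"
    "\<And>j. R j \<in> O[at_right 0](\<lambda>h. h ^ 4)"
proof
  show "(\<lambda>h. stencil f x h j - (\<Sum>m<4. (deriv ^^ m) f x / fact m * (of_int j * h) ^ m))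
          \<in> O[at_right 0](\<lambda>h. h ^ 4)" for j
    using smooth_near_taylor[OF assms, of "of_int j" 4] by (simp add: stencil_def)
  show "stencil f x h j = f x + deriv f x * (of_int j * h) +
          deriv (deriv f) x / 2 * (of_int j * h) ^ 2 +
          deriv (deriv (deriv f)) x / 6 * (of_int j * h) ^ 3 +
          (stencil f x h j - (\<Sum>m<4. (deriv ^^ m) f x / fact m * (of_int j * h) ^ m))" for j h
    by (simp add: eval_nat_numeral)
qed

section \<open>The smoothness indicators\<close>

definition second_diff :: "(int \<Rightarrow> real) \<Rightarrow> nat \<Rightarrow> real" where
  "second_diff v k = v (int k - 2) - 2 * v (int k - 1) + v (int k)"

definition first_diff :: "(int \<Rightarrow> real) \<Rightarrow> nat \<Rightarrow> real" where
  "first_diff v k =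
     [v (-2) - 4 * v (-1) + 3 * v 0, v (-1) - v 1, 3 * v 0 - 4 * v 1 + v 2] ! k"

lemma smoothness_indicator_eq:
  assumes "k \<in> {0, 1, 2}"
  shows "smoothness_indicator v k = 13/12 * second_diff v k ^ 2 + 1/4 * first_diff v k ^ 2"
  using assms by (auto simp: smoothness_indicator_def second_diff_def first_diff_def)

text \<open>The formula for $k = 0$ approximates $2 h f'$, the other two approximate $-2 h f'$.\<close>

definition slope_sign :: "nat \<Rightarrow> real" where
  "slope_sign k = (if k = 0 then 1 else -1)"

lemma bigo_power_at_right_0:
  assumes "m \<le> n"
  shows "(\<lambda>h::real. h ^ n) \<in> O[at_right 0](\<lambda>h. h ^ m)"
proof -
  have "eventually (\<lambda>h::real. h \<in> {0<..<1}) (at_right 0)"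
    by (rule eventually_at_right_real) simp
  then have "eventually (\<lambda>h::real. \<bar>h ^ n\<bar> \<le> 1 * \<bar>h ^ m\<bar>) (at_right 0)"
    by eventually_elim (use assms in \<open>auto intro: power_decreasing\<close>)
  then show ?thesis
    by (intro landau_o.bigI[of 1]) auto
qed

lemma bigo_power_weaken:
  assumes "g \<in> O[at_right 0](\<lambda>h::real. h ^ n)" "m \<le> n"
  shows "g \<in> O[at_right 0](\<lambda>h. h ^ m)"
  using landau_o.big_trans[OF assms(1) bigo_power_at_right_0[OF assms(2)]] .

context
  fixes f :: "real \<Rightarrow> real" and x :: real
  assumes smooth: "smooth_near f x"
begin

text \<open>
  Each $P_k$ and $Q_k$ is a three-point formula annihilating constants, so its expansion is read off
  from the moments of its coefficients. For $Q_k$ the second moment vanishes as well, so its error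
  is two orders beyond its leading term. The sum $Q_0 + Q_2$ has coefficients $1, -4, 6, -4, 1$ and
  annihilates all cubics.
\<close>

lemma stencil_differences:
  assumes "k \<in> {0, 1, 2}"
  shows "(\<lambda>h. second_diff (stencil f x h) k - deriv (deriv f) x * h ^ 2)
           \<in> O[at_right 0](\<lambda>h. h ^ 3)"
    and "(\<lambda>h. first_diff (stencil f x h) k - slope_sign k * 2 * deriv f x * h)
           \<in> O[at_right 0](\<lambda>h. h ^ 3)"
    and "(\<lambda>h. first_diff (stencil f x h) 0 + first_diff (stencil f x h) 2)
           \<in> O[at_right 0](\<lambda>h. h ^ 4)"
proof -
  obtain c R where
    st: "\<And>j h. stencil f x h j = f x + deriv f x * (of_int j * h) +
           deriv (deriv f) x / 2 * (of_int j * h) ^ 2 + c * (of_int j * h) ^ 3 + R j h"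
    and R4: "\<And>j. R j \<in> O[at_right 0](\<lambda>h. h ^ 4)"
    using stencil_taylor[OF smooth] by blast
  have R3: "R j \<in> O[at_right 0](\<lambda>h. h ^ 3)" for j
    using bigo_power_weaken[OF R4] by simp
  have cub: "(\<lambda>h. d * h ^ 3) \<in> O[at_right 0](\<lambda>h::real. h ^ 3)" for d :: real
    by simp
  have sc: "(\<lambda>h. d * R j h) \<in> O[at_right 0](\<lambda>h. h ^ 3)" for d j
    using R3 by (cases "d = 0") simp_all
  have sc4: "(\<lambda>h. d * R j h) \<in> O[at_right 0](\<lambda>h. h ^ 4)" for d j
    using R4 by (cases "d = 0") simp_all
  \<comment> \<open>The cubic term comes from $f''$ at the middle node of the substencil, which is $x + (k - 1) h$.\<close>
  have "\<exists>d. \<forall>h. second_diff (stencil f x h) k - deriv (deriv f) x * h ^ 2 =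
        d * h ^ 3 + 1 * R (int k - 2) h + (-2) * R (int k - 1) h + 1 * R (int k) h"
    using assms
    by (intro exI[of _ "6 * c * (real k - 1)"])
       (auto simp: second_diff_def st field_simps power2_eq_square power3_eq_cube)
  then obtain d where
    "(\<lambda>h. second_diff (stencil f x h) k - deriv (deriv f) x * h ^ 2) =
     (\<lambda>h. d * h ^ 3 + 1 * R (int k - 2) h + (-2) * R (int k - 1) h + 1 * R (int k) h)"
    by blast
  then show "(\<lambda>h. second_diff (stencil f x h) k - deriv (deriv f) x * h ^ 2)
               \<in> O[at_right 0](\<lambda>h. h ^ 3)"
    by (simp only:) (intro sum_in_bigo cub sc)
  have "\<exists>d d1 d2 d3 d4 d5. \<forall>h. first_diff (stencil f x h) k - slope_sign k * 2 * deriv f x * h =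
        d * h ^ 3 + d1 * R (-2) h + d2 * R (-1) h + d3 * R 0 h + d4 * R 1 h + d5 * R 2 h"
  proof -
    consider "k = 0" | "k = 1" | "k = 2" using assms by auto
    then show ?thesis
    proof cases
      case 1
      show ?thesis
        unfolding 1
        by (rule exI[of _ "-4*c"], rule exI[of _ 1], rule exI[of _ "-4"], rule exI[of _ 3],
            rule exI[of _ 0], rule exI[of _ 0],
            auto simp: first_diff_def slope_sign_def st field_simps power2_eq_square power3_eq_cube)
    next
      case 2
      show ?thesis
        unfolding 2
        by (rule exI[of _ "-2*c"], rule exI[of _ 0], rule exI[of _ 1], rule exI[of _ 0],
            rule exI[of _ "-1"], rule exI[of _ 0],
            auto simp: first_diff_def slope_sign_def st field_simps power2_eq_square power3_eq_cube)
    next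
      case 3
      show ?thesis
        unfolding 3
        by (rule exI[of _ "4*c"], rule exI[of _ 0], rule exI[of _ 0], rule exI[of _ 3],
            rule exI[of _ "-4"], rule exI[of _ 1],
            auto simp: first_diff_def slope_sign_def st field_simps power2_eq_square power3_eq_cube)
    qed
  qed
  then obtain d d1 d2 d3 d4 d5 where
    "(\<lambda>h. first_diff (stencil f x h) k - slope_sign k * 2 * deriv f x * h) =
     (\<lambda>h. d * h ^ 3 + d1 * R (-2) h + d2 * R (-1) h + d3 * R 0 h + d4 * R 1 h + d5 * R 2 h)"
    by blast
  then show "(\<lambda>h. first_diff (stencil f x h) k - slope_sign k * 2 * deriv f x * h)
               \<in> O[at_right 0](\<lambda>h. h ^ 3)"
    by (simp only:) (intro sum_in_bigo cub sc)
  have "(\<lambda>h. first_diff (stencil f x h) 0 + first_diff (stencil f x h) 2) =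
        (\<lambda>h. 1 * R (-2) h + (-4) * R (-1) h + 6 * R 0 h + (-4) * R 1 h + 1 * R 2 h)"
    by (auto simp: first_diff_def st field_simps power2_eq_square power3_eq_cube)
  then show "(\<lambda>h. first_diff (stencil f x h) 0 + first_diff (stencil f x h) 2)
               \<in> O[at_right 0](\<lambda>h. h ^ 4)"
    by (simp only:) (intro sum_in_bigo sc4)
qed

text \<open>
  Both squares are treated by the difference of two squares. For the slopes the small factor is the
  sum, because $Q_0$ and $Q_2$ have opposite leading terms.
\<close>

lemma smoothness_indicator_diff:
  "(\<lambda>h. smoothness_indicator (stencil f x h) 0 - smoothness_indicator (stencil f x h) 2)
     \<in> O[at_right 0](\<lambda>h. h ^ 5)"
proof -
  let ?P = "\<lambda>k h. second_diff (stencil f x h) k" and ?Q = "\<lambda>k h. first_diff (stencil f x h) k"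
  define b where "b = deriv (deriv f) x"
  have P: "(\<lambda>h. ?P k h - b * h ^ 2) \<in> O[at_right 0](\<lambda>h. h ^ 3)" if "k \<in> {0, 1, 2}" for k
    using stencil_differences(1)[OF that] by (simp add: b_def)
  have P2: "?P k \<in> O[at_right 0](\<lambda>h. h ^ 2)" if "k \<in> {0, 1, 2}" for k
    using sum_in_bigo(1)[OF bigo_power_weaken[OF P[OF that], of 2], of "\<lambda>h. b * h ^ 2"] by simp
  have Q1: "?Q k \<in> O[at_right 0](\<lambda>h. h ^ 1)" if "k \<in> {0, 1, 2}" for k
    using sum_in_bigo(1)[OF bigo_power_weaken[OF stencil_differences(2)[OF that], of 1],
        of "\<lambda>h. slope_sign k * 2 * deriv f x * h"] by simp
  have PP: "(\<lambda>h. ?P 0 h - ?P 2 h) \<in> O[at_right 0](\<lambda>h. h ^ 3)"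
    using sum_in_bigo(2)[OF P[of 0] P[of 2]] by simp
  have "(\<lambda>h. (?P 0 h - ?P 2 h) * (?P 0 h + ?P 2 h)) \<in> O[at_right 0](\<lambda>h. h ^ 3 * h ^ 2)"
    by (intro landau_o.big.mult PP sum_in_bigo P2) auto
  moreover have "(\<lambda>h. (?Q 0 h + ?Q 2 h) * (?Q 0 h - ?Q 2 h)) \<in> O[at_right 0](\<lambda>h. h ^ 4 * h ^ 1)"
    by (intro landau_o.big.mult stencil_differences(3)[of 0] sum_in_bigo Q1) auto
  ultimately have "(\<lambda>h. 13/12 * ((?P 0 h - ?P 2 h) * (?P 0 h + ?P 2 h)) +
      1/4 * ((?Q 0 h + ?Q 2 h) * (?Q 0 h - ?Q 2 h))) \<in> O[at_right 0](\<lambda>h. h ^ 5)"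
    by (intro sum_in_bigo) (simp_all flip: power_add power_Suc2 power_Suc)
  then show ?thesis
    by (simp add: smoothness_indicator_eq algebra_simps power2_eq_square)
qed

text \<open>
  If $f'(x) \neq 0$, the slope part dominates with $\frac14 (\pm 2 a h)^2 = a^2 h^2$. If $f'(x) = 0$,
  the slope part is $O(h^6)$ and the curvature part takes over.
\<close>

lemma smoothness_indicator_leading_term:
  assumes "k \<in> {0, 1, 2}"
  shows "((\<lambda>h. smoothness_indicator (stencil f x h) k / h ^ 2) \<longlongrightarrow> deriv f x ^ 2) (at_right 0)"
    and "deriv f x = 0 \<Longrightarrow>
         ((\<lambda>h. smoothness_indicator (stencil f x h) k / h ^ 4) \<longlongrightarrow> 13/12 * deriv (deriv f) x ^ 2)
           (at_right 0)"
proof -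
  let ?P = "\<lambda>h. second_diff (stencil f x h) k" and ?Q = "\<lambda>h. first_diff (stencil f x h) k"
  have lead: "((\<lambda>h. g h / h ^ n) \<longlongrightarrow> u) (at_right 0)"
    if "(\<lambda>h. g h - u * h ^ n) \<in> O[at_right 0](\<lambda>h. h ^ Suc n)" for g :: "real \<Rightarrow> real" and u n
  proof -
    have "(\<lambda>h::real. h) \<in> o[at_right 0](\<lambda>_. 1)"
      by (intro smalloI_tendsto) (auto intro!: tendsto_intros)
    then have "(\<lambda>h::real. h * h ^ n) \<in> o[at_right 0](\<lambda>h. 1 * h ^ n)"
      by (intro landau_o.small_big_mult) auto
    with that have "(\<lambda>h. g h - u * h ^ n) \<in> o[at_right 0](\<lambda>h. h ^ n)"
      using landau_o.big_small_trans by fastforce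
    then have "((\<lambda>h. (g h - u * h ^ n) / h ^ n) \<longlongrightarrow> 0) (at_right 0)"
      by (rule smalloD_tendsto)
    moreover have "eventually (\<lambda>h. (g h - u * h ^ n) / h ^ n = g h / h ^ n - u) (at_right 0)"
      using eventually_at_right_less[of "0::real"]
      by eventually_elim (simp add: diff_divide_distrib)
    ultimately have "((\<lambda>h. g h / h ^ n - u) \<longlongrightarrow> 0) (at_right 0)"
      by (rule Lim_transform_eventually)
    then show ?thesis
      by (rule LIM_zero_cancel)
  qed
  have comb: "((\<lambda>h. smoothness_indicator (stencil f x h) k / h ^ (2 * n))
                 \<longlongrightarrow> 13/12 * u ^ 2 + 1/4 * w ^ 2) (at_right 0)"
    if "((\<lambda>h. ?P h / h ^ n) \<longlongrightarrow> u) (at_right 0)" "((\<lambda>h. ?Q h / h ^ n) \<longlongrightarrow> w) (at_right 0)"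
    for n u w
  proof -
    have "((\<lambda>h. 13/12 * (?P h / h ^ n) ^ 2 + 1/4 * (?Q h / h ^ n) ^ 2)
            \<longlongrightarrow> 13/12 * u ^ 2 + 1/4 * w ^ 2) (at_right 0)"
      by (intro tendsto_intros that)
    then show ?thesis
      by (simp add: smoothness_indicator_eq[OF assms] power_divide add_divide_distrib
          power_mult[symmetric] mult.commute)
  qed
  note P = stencil_differences(1)[OF assms] and Q = stencil_differences(2)[OF assms]
  have P1: "(\<lambda>h. ?P h - 0 * h ^ 1) \<in> O[at_right 0](\<lambda>h. h ^ Suc 1)"
    using sum_in_bigo(1)[OF bigo_power_weaken[OF P, of 2], of "\<lambda>h. deriv (deriv f) x * h ^ 2"]
    by (simp add: numeral_2_eq_2)
  have Q1: "(\<lambda>h. ?Q h - (slope_sign k * 2 * deriv f x) * h ^ 1)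
                   \<in> O[at_right 0](\<lambda>h. h ^ Suc 1)"
    using bigo_power_weaken[OF Q, of 2] by (simp add: numeral_2_eq_2)
  show "((\<lambda>h. smoothness_indicator (stencil f x h) k / h ^ 2) \<longlongrightarrow> deriv f x ^ 2)
                     (at_right 0)"
    using comb[OF lead[OF P1] lead[OF Q1]]
    by (simp add: slope_sign_def power_mult_distrib split: if_splits)
  assume a: "deriv f x = 0"
  have P2: "(\<lambda>h. ?P h - deriv (deriv f) x * h ^ 2) \<in> O[at_right 0](\<lambda>h. h ^ Suc 2)"
    using P by (simp add: eval_nat_numeral)
  have Q2: "(\<lambda>h. ?Q h - 0 * h ^ 2) \<in> O[at_right 0](\<lambda>h. h ^ Suc 2)"
    using Q a by (simp add: eval_nat_numeral)
  show "((\<lambda>h. smoothness_indicator (stencil f x h) k / h ^ 4)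
                      \<longlongrightarrow> 13/12 * deriv (deriv f) x ^ 2) (at_right 0)"
    using comb[OF lead[OF P2] lead[OF Q2]] by simp
qed

end

section \<open>From the smoothness indicators to the weights\<close>

text \<open>
  The powers near a positive limit are Lipschitz, by the mean value theorem: the derivative is
  bounded on a compact neighbourhood of the limit that excludes 0.
\<close>

lemma powr_diff_bigo:
  fixes g1 g2 :: "'a \<Rightarrow> real"
  assumes "(g1 \<longlongrightarrow> C) F" "(g2 \<longlongrightarrow> C) F" "C > 0"
  shows "(\<lambda>t. g1 t powr q - g2 t powr q) \<in> O[F](\<lambda>t. g1 t - g2 t)"
proof -
  define I where "I = {C / 2..2 * C}"
  have "continuous_on I (\<lambda>u. q * u powr (q - 1))"
    unfolding I_def using assms(3) by (intro continuous_intros) auto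
  then have "bounded ((\<lambda>u. q * u powr (q - 1)) ` I)"
    unfolding I_def by (intro compact_imp_bounded compact_continuous_image) auto
  then obtain M where M: "\<And>u. u \<in> I \<Longrightarrow> \<bar>q * u powr (q - 1)\<bar> \<le> M"
    unfolding bounded_iff by (metis imageI real_norm_def)
  have lip: "\<bar>u powr q - w powr q\<bar> \<le> M * \<bar>u - w\<bar>" if "u \<in> I" "w \<in> I" for u w
  proof -
    have "((\<lambda>u. u powr q) has_field_derivative q * z powr (q - 1)) (at z within I)" if "z \<in> I" for z
      using that assms(3) unfolding I_def
      by (intro has_real_derivative_powr[THEN has_field_derivative_at_within]) auto
    then show ?thesis
      using field_differentiable_bound[of I "\<lambda>u. u powr q" "\<lambda>z. q * z powr (q - 1)" M w u] M that
      unfolding I_def by (auto simp: abs_minus_commute)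
  qed
  have "eventually (\<lambda>t. g1 t \<in> {C / 2<..<2 * C}) F" "eventually (\<lambda>t. g2 t \<in> {C / 2<..<2 * C}) F"
    using topological_tendstoD[OF assms(1) open_greaterThanLessThan, of "C / 2" "2 * C"]
      topological_tendstoD[OF assms(2) open_greaterThanLessThan, of "C / 2" "2 * C"] assms(3)
    by simp_all
  then have "eventually (\<lambda>t. \<bar>g1 t powr q - g2 t powr q\<bar> \<le> M * \<bar>g1 t - g2 t\<bar>) F"
    by eventually_elim (intro lip, auto simp: I_def)
  then show ?thesis
    by (intro bigoI[of _ M]) simp
qed

text \<open>
  With $r_s \geq 0$ the relative perturbations of the unnormalised weights, the normalising sum is
  $1 + \sum_s d_s r_s \geq 1$. Hence
  $|\omega_k - d_k| = d_k |r_k - \sum_s d_s r_s| / (1 + \sum_s d_s r_s)$ is at most the larger of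
  $r_k$ and the weighted mean $\sum_s d_s r_s$.
\<close>

lemma omega_ZR_diff_le:
  fixes p :: real and v :: "int \<Rightarrow> real"
  defines "r \<equiv> \<lambda>s. (tau_ZR p v / smoothness_indicator v s powr (1/p)) powr p"
  assumes "k \<in> {0, 1, 2}"
  shows "\<bar>omega_ZR p v k - linear_weight k\<bar> \<le> r 0 + r 1 + r 2"
proof -
  have r: "r s \<ge> 0" for s by (simp add: r_def)
  define D where "D = 1/10 * r 0 + 3/5 * r 1 + 3/10 * r 2"
  have D: "0 \<le> D" "D \<le> r 0 + r 1 + r 2"
    using r[of 0] r[of 1] r[of 2] by (auto simp: D_def)
  define d where "d = linear_weight k"
  have d: "0 \<le> d" "d \<le> 1" using assms(2) by (auto simp: d_def linear_weight_def)
  have rk: "0 \<le> r k" "r k \<le> r 0 + r 1 + r 2" using assms(2) r[of 0] r[of 1] r[of 2] by auto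
  have al: "alpha_ZR p v s = linear_weight s * (1 + r s)" for s
    by (simp add: alpha_ZR_def r_def)
  have "(\<Sum>s=0..2. alpha_ZR p v s) = 1 + D"
    by (simp add: al D_def linear_weight_def eval_nat_numeral field_simps)
  then have "omega_ZR p v k - linear_weight k = d * (r k - D) / (1 + D)"
    using D(1) by (simp add: omega_ZR_def al d_def field_simps)
  also have "\<bar>\<dots>\<bar> = d * (\<bar>r k - D\<bar> / (1 + D))"
    using D(1) d by (simp add: abs_mult)
  also have "\<dots> \<le> 1 * (\<bar>r k - D\<bar> / 1)"
    using D(1) d by (intro mult_mono divide_left_mono) auto
  also have "\<dots> \<le> r 0 + r 1 + r 2"
    using D rk by auto
  finally show ?thesis .
qed

text \<open>
  Here $m$ is the order at which all indicators vanish, and $n$ is the number of further orders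
  gained by cancellation in $\beta_0 - \beta_2$. The common limit $C$ puts $\beta_0 / h^m$ and
  $\beta_2 / h^m$ in the region where the $1/p$-th power is Lipschitz, so the gain of $n$ orders
  survives the root.
\<close>

lemma omega_ZR_bigo:
  fixes v :: "real \<Rightarrow> int \<Rightarrow> real"
  assumes lim: "\<And>s. s \<in> {0, 1, 2} \<Longrightarrow>
                  ((\<lambda>h. smoothness_indicator (v h) s / h ^ m) \<longlongrightarrow> C) (at_right 0)"
    and C: "C > 0"
    and diff: "(\<lambda>h. smoothness_indicator (v h) 0 - smoothness_indicator (v h) 2)
                 \<in> O[at_right 0](\<lambda>h. h ^ (m + n))"
    and p: "p > 0" and k: "k \<in> {0, 1, 2}"
  shows "(\<lambda>h. omega_ZR p (v h) k - linear_weight k) \<in> O[at_right 0](\<lambda>h. h powr (real n * p))"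
proof -
  define g where "g s h = smoothness_indicator (v h) s / h ^ m" for s h
  have g: "(g s \<longlongrightarrow> C) (at_right 0)" if "s \<in> {0, 1, 2}" for s
    using lim[OF that] unfolding g_def .
  have pos: "eventually (\<lambda>h::real. h > 0) (at_right 0)"
    by (simp add: eventually_at_right_less)
  have "(\<lambda>h. (smoothness_indicator (v h) 0 - smoothness_indicator (v h) 2) / h ^ m)
          \<in> O[at_right 0](\<lambda>h. h ^ (m + n) / h ^ m)"
    unfolding divide_inverse by (intro landau_o.big.mult diff landau_o.big_refl)
  also have "(\<lambda>h. h ^ (m + n) / h ^ m) \<in> \<Theta>[at_right 0](\<lambda>h::real. h ^ n)"
  proof (rule bigthetaI_cong)
    show "eventually (\<lambda>h::real. h ^ (m + n) / h ^ m = h ^ n) (at_right 0)"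
      using pos by eventually_elim (simp add: power_add)
  qed
  finally have gdiff: "(\<lambda>h. g 0 h - g 2 h) \<in> O[at_right 0](\<lambda>h. h ^ n)"
    by (simp add: g_def diff_divide_distrib)
  have "(\<lambda>h. g 0 h powr (1/p) - g 2 h powr (1/p)) \<in> O[at_right 0](\<lambda>h. g 0 h - g 2 h)"
    by (rule powr_diff_bigo[OF g g C]) auto
  also note gdiff
  finally have num: "(\<lambda>h. \<bar>g 0 h powr (1/p) - g 2 h powr (1/p)\<bar>) \<in> O[at_right 0](\<lambda>h. h ^ n)"
    by simp
  define r where
    "r s h = (tau_ZR p (v h) / smoothness_indicator (v h) s powr (1/p)) powr p" for s h
  have r: "r s \<in> O[at_right 0](\<lambda>h. h powr (real n * p))" if s: "s \<in> {0, 1, 2}" for s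
  proof -
    have "((\<lambda>h. inverse (g s h powr (1/p))) \<longlongrightarrow> inverse (C powr (1/p))) (at_right 0)"
      using C by (intro tendsto_intros g s) auto
    then have "(\<lambda>h. inverse (g s h powr (1/p))) \<in> O[at_right 0](\<lambda>_. 1)"
      using C by (intro bigoI_tendsto[where c = "inverse (C powr (1/p))"]) auto
    from landau_o.big.mult[OF num this]
    have "(\<lambda>h. \<bar>g 0 h powr (1/p) - g 2 h powr (1/p)\<bar> / g s h powr (1/p))
            \<in> O[at_right 0](\<lambda>h. h ^ n)"
      by (simp add: divide_inverse)
    then obtain K where K: "K > 0"
      "eventually (\<lambda>h. \<bar>\<bar>g 0 h powr (1/p) - g 2 h powr (1/p)\<bar> / g s h powr (1/p)\<bar> \<le> K * \<bar>h ^ n\<bar>)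
         (at_right 0)"
      by (auto elim!: landau_o.bigE)
    have "eventually (\<lambda>h. g t h > 0) (at_right 0)" if "t \<in> {0, 1, 2}" for t
      using g[OF that] C by (rule order_tendstoD)
    then have "eventually (\<lambda>h. g 0 h > 0) (at_right 0)" "eventually (\<lambda>h. g 2 h > 0) (at_right 0)"
      "eventually (\<lambda>h. g s h > 0) (at_right 0)" using s by auto
    with K(2) pos have "eventually (\<lambda>h. \<bar>r s h\<bar> \<le> K powr p * \<bar>h powr (real n * p)\<bar>) (at_right 0)"
    proof eventually_elim
      case (elim h)
      \<comment> \<open>The common scale of the indicators, which cancels in $\tau / \beta_s^{1/p}$.\<close>
      define z where "z = (h ^ m) powr (1/p)"
      have z: "z > 0" using elim by (simp add: z_def)
      have scale: "smoothness_indicator (v h) t powr (1/p) = z * g t h powr (1/p)"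
        if "g t h > 0" for t
      proof -
        have "smoothness_indicator (v h) t = h ^ m * g t h"
          using elim by (simp add: g_def)
        then show ?thesis
          using elim that by (simp add: powr_mult z_def)
      qed
      have "tau_ZR p (v h) / smoothness_indicator (v h) s powr (1/p) =
            \<bar>g 0 h powr (1/p) - g 2 h powr (1/p)\<bar> / g s h powr (1/p)"
        using elim z unfolding tau_ZR_def
        by (simp add: scale abs_mult flip: right_diff_distrib)
      also have "\<dots> \<le> K * h ^ n"
        using elim by simp
      finally have "r s h \<le> (K * h ^ n) powr p"
        unfolding r_def using p by (intro powr_mono2) (auto simp: tau_ZR_def)
      also have "\<dots> = K powr p * h powr (real n * p)"
        using K elim by (simp add: powr_mult powr_powr flip: powr_realpow)
      finally show ?case by (simp add: r_def)
    qed
    then show ?thesis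
      by (intro bigoI[of _ "K powr p"]) simp
  qed
  have "(\<lambda>h. omega_ZR p (v h) k - linear_weight k) \<in> O[at_right 0](\<lambda>h. r 0 h + r 1 h + r 2 h)"
    using omega_ZR_diff_le[OF k] unfolding r_def
    by (intro bigoI[of _ 1] always_eventually) (auto intro: order_trans[OF _ abs_ge_self])
  also have "(\<lambda>h. r 0 h + r 1 h + r 2 h) \<in> O[at_right 0](\<lambda>h. h powr (real n * p))"
    by (intro sum_in_bigo r) auto
  finally show ?thesis .
qed

lemma bigo_powr_weaken_cube:
  assumes "g \<in> O[at_right 0](\<lambda>h::real. h powr q)" "q \<ge> 3"
  shows "g \<in> O[at_right 0](\<lambda>h. h ^ 3)"
proof -
  have "eventually (\<lambda>h::real. h \<in> {0<..<1}) (at_right 0)"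
    by (rule eventually_at_right_real) simp
  then have "eventually (\<lambda>h::real. norm (h powr q) \<le> 1 * norm (h ^ 3)) (at_right 0)"
  proof eventually_elim
    case (elim h)
    then show ?case
      using powr_mono'[of 3 q h] assms(2) by simp
  qed
  then have "(\<lambda>h::real. h powr q) \<in> O[at_right 0](\<lambda>h. h ^ 3)"
    by (rule bigoI)
  with assms(1) show ?thesis
    by (rule landau_o.big_trans)
qed

theorem mainTheorem2:
  fixes f :: "real \<Rightarrow> real" and x p :: real and k :: nat
  assumes "smooth_near f x"
    and "p > 0"
    and "k \<in> {0, 1, 2}"
  shows "(deriv f x \<noteq> 0 \<longrightarrow>
           (\<lambda>h. omega_ZR p (stencil f x h) k - linear_weight k) \<in> O[at_right 0](\<lambda>h. h powr (3 * p))
           \<and> (p \<ge> 1 \<longrightarrow>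
              (\<lambda>h. omega_ZR p (stencil f x h) k - linear_weight k) \<in> O[at_right 0](\<lambda>h. h ^ 3)))
       \<and> (deriv f x = 0 \<and> deriv (deriv f) x \<noteq> 0 \<longrightarrow>
           (\<lambda>h. omega_ZR p (stencil f x h) k - linear_weight k) \<in> O[at_right 0](\<lambda>h. h powr p)
           \<and> (p \<ge> 3 \<longrightarrow>
              (\<lambda>h. omega_ZR p (stencil f x h) k - linear_weight k) \<in> O[at_right 0](\<lambda>h. h ^ 3)))"
proof (intro conjI impI; (elim conjE)?)
  let ?e = "\<lambda>h. omega_ZR p (stencil f x h) k - linear_weight k"
  note lead = smoothness_indicator_leading_term[OF assms(1)]
  note diff = smoothness_indicator_diff[OF assms(1)]
  {
    assume a: "deriv f x \<noteq> 0"
    show *: "?e \<in> O[at_right 0](\<lambda>h. h powr (3 * p))"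
      using omega_ZR_bigo[OF lead(1), where p = p and k = k and n = 3] a diff assms(2,3) by simp
    show "?e \<in> O[at_right 0](\<lambda>h. h ^ 3)" if "p \<ge> 1"
      using bigo_powr_weaken_cube[OF *] that by simp
  next
    assume a: "deriv f x = 0" and b: "deriv (deriv f) x \<noteq> 0"
    show *: "?e \<in> O[at_right 0](\<lambda>h. h powr p)"
      using omega_ZR_bigo[OF lead(2), where p = p and k = k and n = 1] a b diff assms(2,3) by simp
    show "?e \<in> O[at_right 0](\<lambda>h. h ^ 3)" if "p \<ge> 3"
      using bigo_powr_weaken_cube[OF *] that by simp
  }
qed

end
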